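(* For every $n\geq1$, $$\sum_{\pi\in\mathfrak{S}_n(123)}t^{\mathrm{des}(\pi)}=\sum_{e\in\mathbf{I}_n(\geq,-,\geq)}t^{\mathrm{dist}(e)}.$$
   Context: $\mathfrak{S}_n$ is the set of permutations $\pi=\pi_1\cdots\pi_n$ of $\{1,\ldots,n\}$. $\mathfrak{S}_n(123)$ is the set of permutations with no indices $i<j<k$ such that $\pi_i<\pi_j<\pi_k$. $\mathrm{des}(\pi)$ is the number of $i\in\{1,\ldots,n-1\}$ with $\pi_i>\pi_{i+1}$. $\mathbf{I}_n=\{(e_1,\ldots,e_n): 0\leq e_i<i\}$ is the set of inversion sequences. $\mathbf{I}_n(\geq,-,\geq)$ is the set of $e\in\mathbf{I}_n$ with no $i<j<k$ such that $e_i\geq e_j$ and $e_i\geq e_k$. $\mathrm{dist}(e)$ is the number of distinct positive values among $e_1,\ldots,e_n$. *)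

theory Defs
  imports
    "HOL-Combinatorics.Multiset_Permutations"
    "HOL-Computational_Algebra.Polynomial"
begin

text \<open>
  Permutations and inversion sequences are lists of naturals. List positions start at 0,
  so the mathematical entry with index \<open>i\<close> is the list entry \<open>! (i - 1)\<close>.
\<close>

definition contains_123 :: "nat list \<Rightarrow> bool" where
  "contains_123 p \<longleftrightarrow>
     (\<exists>i j k. i < j \<and> j < k \<and> k < length p \<and> p ! i < p ! j \<and> p ! j < p ! k)"

definition perms_avoiding_123 :: "nat \<Rightarrow> nat list set" where
  "perms_avoiding_123 n = {p \<in> permutations_of_set {1..n}. \<not> contains_123 p}"

definition des :: "nat list \<Rightarrow> nat" where
  "des p = card {i. Suc i < length p \<and> p ! i > p ! Suc i}"

text \<open>In 0-based positions the bound \<open>e\<^sub>i < i\<close> becomes \<open>e ! i < Suc i\<close>.\<close>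

definition inv_seqs :: "nat \<Rightarrow> nat list set" where
  "inv_seqs n = {e. length e = n \<and> (\<forall>i<n. e ! i < Suc i)}"

definition contains_ge_any_ge :: "nat list \<Rightarrow> bool" where
  "contains_ge_any_ge e \<longleftrightarrow>
     (\<exists>i j k. i < j \<and> j < k \<and> k < length e \<and> e ! i \<ge> e ! j \<and> e ! i \<ge> e ! k)"

definition inv_seqs_avoiding_ge_any_ge :: "nat \<Rightarrow> nat list set" where
  "inv_seqs_avoiding_ge_any_ge n = {e \<in> inv_seqs n. \<not> contains_ge_any_ge e}"

definition dist_pos :: "nat list \<Rightarrow> nat" where
  "dist_pos e = card {x \<in> set e. x > 0}"

end

theory Submission
  imports Defs "HOL-Computational_Algebra.Formal_Power_Series"
begin

text \<open>
  Multiplied by \<open>t\<close>, both sides are the coefficient of \<open>X\<^sup>n\<close> in the power series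
  \<open>\<lambda> = 1 + (t X + (t - t\<^sup>2) X\<^sup>2) \<lambda>\<^sup>2\<close>. On each side a transfer-matrix
  recursion has an explicit solution, found by the kernel method, in terms of \<open>\<lambda>\<close> and the series
  \<open>\<mu> = \<lambda> (1 + t X \<mu>)\<close> and \<open>\<nu> = t (1 + X \<mu>)\<close>.

  A 123-avoiding permutation is read from left to right. If \<open>m\<close> is the minimum so far, the next entry
  is either below \<open>m\<close> or the largest remaining entry, so only the numbers \<open>a\<close> and \<open>b\<close> of remaining
  entries above and below \<open>m\<close> matter, together with whether \<open>m\<close> is the latest entry.

  An inversion sequence \<open>e\<close> is extended on the right. Let \<open>U - 1\<close> be its maximum and let \<open>L - 1\<close> be
  the largest entry that is already followed by an entry that is not larger. The next entry can be any
  \<open>x\<close> with \<open>L \<le> x \<le> length e\<close>: if \<open>x \<ge> U\<close>, it only replaces \<open>U\<close> by \<open>x + 1\<close>, otherwise it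
  raises \<open>L\<close> to \<open>U\<close>. The weight of all extensions is affine in \<open>k + t s\<close>, where \<open>k\<close> and \<open>s\<close> count the
  used and the unused values in \<open>{L..<U}\<close>.
\<close>

unbundle fps_syntax

subsection \<open>The common power series\<close>

text \<open>Coefficientwise form of the quadratic equation; its \<open>X^2\<close> term contributes
  only from index 2 on. At \<open>t = 1\<close> these are the Catalan numbers.\<close>

fun lam_coeff :: "'a::comm_ring_1 \<Rightarrow> nat \<Rightarrow> 'a" where
  "lam_coeff t 0 = 1"
| "lam_coeff t (Suc 0) = t"
| "lam_coeff t (Suc (Suc n)) =
     t * (\<Sum>i=0..Suc n. lam_coeff t i * lam_coeff t (Suc n - i)) +
     (t - t\<^sup>2) * (\<Sum>i=0..n. lam_coeff t i * lam_coeff t (n - i))"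

definition lam :: "'a::comm_ring_1 \<Rightarrow> 'a fps" where
  "lam t = Abs_fps (lam_coeff t)"

lemma lam_quadratic:
  "lam t = 1 + fps_X * (fps_const t + fps_const (t - t\<^sup>2) * fps_X) * lam t * lam t"
proof (rule fps_ext)
  fix n
  define Q where "Q = lam t * lam t"
  have Q: "Q $ k = (\<Sum>i=0..k. lam_coeff t i * lam_coeff t (k - i))" for k
    by (simp add: Q_def fps_mult_nth lam_def)
  \<comment> \<open>Every summand gets an outer factor \<open>fps_X\<close>, so that coefficients at
    successors are plain shifts.\<close>
  have *: "fps_X * (fps_const t + fps_const (t - t\<^sup>2) * fps_X) * lam t * lam t =
      fps_X * (fps_const t * Q + fps_X * (fps_const (t - t\<^sup>2) * Q))"
    unfolding Q_def by (simp only: algebra_simps)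
  consider "n = 0" | "n = 1" | m where "n = Suc (Suc m)"
    by (metis One_nat_def not0_implies_Suc)
  then show "lam t $ n =
    (1 + fps_X * (fps_const t + fps_const (t - t\<^sup>2) * fps_X) * lam t * lam t) $ n"
    unfolding * by cases (simp_all add: Q lam_def del: sum.atLeast0_atMost_Suc)
qed

text \<open>The factor that turns the quadratic into \<lambda> = 1 + X \<lambda> \<nu>.\<close>

definition nu :: "'a::comm_ring_1 \<Rightarrow> 'a fps" where
  "nu t = (fps_const t + fps_const (t - t\<^sup>2) * fps_X) * lam t"

text \<open>An explicit expression replaces the circular equation \<mu> = \<lambda> (1 + t X \<mu>);
  the two agree by \<open>nu_eq\<close>.\<close>

definition mu :: "'a::comm_ring_1 \<Rightarrow> 'a fps" where
  "mu t = lam t * (nu t + 1 - fps_const t)"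

lemma lam_eq_nu: "lam t = 1 + fps_X * lam t * nu t"
  using lam_quadratic[of t] by (simp add: nu_def mult_ac)

lemma nu_eq: "nu t = fps_const t + fps_const t * fps_X * mu t"
proof -
  have "nu t = fps_const t * (lam t + fps_X * lam t - fps_const t * fps_X * lam t)"
    by (simp add: nu_def algebra_simps power2_eq_square flip: fps_const_mult fps_const_sub)
  also have "\<dots> = fps_const t * (1 + fps_X * lam t * nu t + fps_X * lam t - fps_const t * fps_X * lam t)"
    using lam_eq_nu[of t] by simp
  also have "\<dots> = fps_const t + fps_const t * fps_X * mu t"
    by (simp add: mu_def algebra_simps)
  finally show ?thesis .
qed

lemma lam_eq: "lam t = 1 + fps_const t * fps_X * lam t * (1 + fps_X * mu t)"
  using lam_eq_nu[of t] by (simp add: nu_eq algebra_simps)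

lemma mu_eq: "mu t = lam t + fps_const t * fps_X * lam t * mu t"
proof -
  have "mu t = lam t * (nu t + 1 - fps_const t)"
    by (rule mu_def)
  then show ?thesis
    unfolding nu_eq by (simp add: algebra_simps)
qed

text \<open>By \<open>lam_eq\<close>, the series 1 - t X (1 + X \<mu>) is inverse to \<lambda>;
  multiplying \<open>mu_eq\<close> by it eliminates \<lambda>.\<close>

lemma mu_quadratic:
  "mu t = 1 + 2 * fps_const t * fps_X * mu t + fps_const t * fps_X\<^sup>2 * (mu t)\<^sup>2"
proof -
  define c where "c = fps_const t * fps_X"
  have m: "mu t = lam t + c * lam t * mu t" and l: "lam t = 1 + c * lam t * (1 + fps_X * mu t)"
    using mu_eq[of t] lam_eq[of t] by (simp_all add: c_def)
  have "mu t * (1 - c * (1 + fps_X * mu t)) = (lam t + c * lam t * mu t) * (1 - c * (1 + fps_X * mu t))"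
    using m by simp
  also have "\<dots> = (lam t - c * lam t * (1 + fps_X * mu t)) * (1 + c * mu t)"
    by (simp add: algebra_simps)
  also have "lam t - c * lam t * (1 + fps_X * mu t) = 1"
    using l by (simp add: algebra_simps)
  finally show ?thesis
    by (simp add: c_def algebra_simps power2_eq_square)
qed

subsection \<open>Permutations\<close>

text \<open>What is left of a 123 pattern once its smallest letter \<open>x\<close> is put in
  front.\<close>

definition asc_above :: "nat \<Rightarrow> nat list \<Rightarrow> bool" where
  "asc_above x p \<longleftrightarrow> (\<exists>j k. j < k \<and> k < length p \<and> x < p ! j \<and> p ! j < p ! k)"

lemma asc_above_Cons:
  "asc_above x (y # q) \<longleftrightarrow> x < y \<and> (\<exists>z\<in>set q. y < z) \<or> asc_above x q"
proof
  assume "asc_above x (y # q)"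
  then obtain j k where jk: "j < k" "k < length (y # q)" "x < (y # q) ! j" "(y # q) ! j < (y # q) ! k"
    by (auto simp: asc_above_def)
  from jk(1) obtain k' where k: "k = Suc k'" by (cases k) auto
  show "x < y \<and> (\<exists>z\<in>set q. y < z) \<or> asc_above x q"
    using jk by (cases j) (auto simp: k asc_above_def)
next
  assume "x < y \<and> (\<exists>z\<in>set q. y < z) \<or> asc_above x q"
  then show "asc_above x (y # q)"
  proof
    assume "x < y \<and> (\<exists>z\<in>set q. y < z)"
    then obtain k where "k < length q" "y < q ! k" "x < y"
      by (auto simp: in_set_conv_nth)
    then have "0 < Suc k \<and> Suc k < length (y # q) \<and> x < (y # q) ! 0 \<and> (y # q) ! 0 < (y # q) ! Suc k"
      by simp
    then show ?thesis unfolding asc_above_def by blast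
  next
    assume "asc_above x q"
    then obtain j k where "j < k" "k < length q" "x < q ! j" "q ! j < q ! k"
      by (auto simp: asc_above_def)
    then have "Suc j < Suc k \<and> Suc k < length (y # q) \<and> x < (y # q) ! Suc j \<and> (y # q) ! Suc j < (y # q) ! Suc k"
      by simp
    then show ?thesis unfolding asc_above_def by blast
  qed
qed

lemma asc_above_antimono: "asc_above x p \<Longrightarrow> y \<le> x \<Longrightarrow> asc_above y p"
  by (auto simp: asc_above_def) (meson le_less_trans)

lemma contains_123_Cons: "contains_123 (x # p) \<longleftrightarrow> asc_above x p \<or> contains_123 p"
proof
  assume "contains_123 (x # p)"
  then obtain i j k where ijk: "i < j" "j < k" "k < length (x # p)"
    "(x # p) ! i < (x # p) ! j" "(x # p) ! j < (x # p) ! k"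
    by (auto simp: contains_123_def)
  from ijk obtain j' k' where jk: "j = Suc j'" "k = Suc k'" by (cases j; cases k) auto
  show "asc_above x p \<or> contains_123 p"
    using ijk by (cases i) (auto simp: jk asc_above_def contains_123_def)
next
  assume "asc_above x p \<or> contains_123 p"
  then show "contains_123 (x # p)"
  proof
    assume "asc_above x p"
    then obtain j k where "j < k" "k < length p" "x < p ! j" "p ! j < p ! k"
      by (auto simp: asc_above_def)
    then have "0 < Suc j \<and> Suc j < Suc k \<and> Suc k < length (x # p) \<and>
       (x # p) ! 0 < (x # p) ! Suc j \<and> (x # p) ! Suc j < (x # p) ! Suc k"
      by simp
    then show ?thesis unfolding contains_123_def by blast
  next
    assume "contains_123 p"
    then obtain i j k where "i < j" "j < k" "k < length p" "p ! i < p ! j" "p ! j < p ! k"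
      by (auto simp: contains_123_def)
    then have "Suc i < Suc j \<and> Suc j < Suc k \<and> Suc k < length (x # p) \<and>
       (x # p) ! Suc i < (x # p) ! Suc j \<and> (x # p) ! Suc j < (x # p) ! Suc k"
      by simp
    then show ?thesis unfolding contains_123_def by blast
  qed
qed

text \<open>A pattern starting at \<open>m\<close> can start at the smaller \<open>y\<close>
  instead, so a new minimum makes the old one irrelevant.\<close>

lemma contains_123_Cons_Cons_less:
  "y < m \<Longrightarrow> contains_123 (m # y # q) \<longleftrightarrow> contains_123 (y # q)"
  using asc_above_antimono[of m q y] by (auto simp: contains_123_Cons asc_above_Cons)

text \<open>With nothing larger after it, \<open>y\<close> can only end a pattern, and a single
  letter in front is too few for that.\<close>

lemma contains_123_Cons_Cons_max:
  "m < y \<Longrightarrow> \<forall>z\<in>set q. z < y \<Longrightarrow> contains_123 (m # y # q) \<longleftrightarrow> contains_123 (m # q)"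
  using asc_above_antimono[of y q m] by (auto simp: contains_123_Cons asc_above_Cons)

lemma contains_123_Cons_Cons_greater:
  "m < y \<Longrightarrow> z \<in> set q \<Longrightarrow> y < z \<Longrightarrow> contains_123 (m # y # q)"
  by (auto simp: contains_123_Cons asc_above_Cons)

lemma des_Cons_Cons: "des (x # y # q) = (if x > y then 1 else 0) + des (y # q)"
proof -
  have "{i. Suc i < length (x # y # q) \<and> (x # y # q) ! i > (x # y # q) ! Suc i} =
    (if x > y then {0} else {}) \<union> Suc ` {i. Suc i < length (y # q) \<and> (y # q) ! i > (y # q) ! Suc i}"
    (is "?L = ?Z \<union> Suc ` ?M")
  proof (intro set_eqI)
    fix i show "i \<in> ?L \<longleftrightarrow> i \<in> ?Z \<union> Suc ` ?M"
      by (cases i) (auto simp: image_iff)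
  qed
  moreover have "finite ?M"
    by (rule finite_subset[of _ "{..<length (y # q)}"]) auto
  ultimately show ?thesis
    unfolding des_def by (auto simp: card_image card_insert_if)
qed

lemma des_singleton: "des [x] = 0"
  by (simp add: des_def)

text \<open>The ways to continue a 123-avoiding word with minimum \<open>m\<close> by the letters of \<open>S\<close>.\<close>

definition completions :: "nat set \<Rightarrow> nat \<Rightarrow> nat list set" where
  "completions S m = {p \<in> permutations_of_set S. \<not> contains_123 (m # p)}"

lemma finite_completions: "finite S \<Longrightarrow> finite (completions S m)"
  by (simp add: completions_def)

lemma completions_empty: "completions {} m = {[]}"
  by (auto simp: completions_def contains_123_def)

lemma Cons_in_completions:
  assumes "finite S" "m \<notin> S"
  shows "y # q \<in> completions S m \<longleftrightarrow>
    y \<in> S \<and> (y < m \<and> q \<in> completions (S - {y}) y \<or>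
              m < y \<and> (\<forall>z\<in>S. z \<le> y) \<and> q \<in> completions (S - {y}) m)"
proof (cases "y \<in> S \<and> q \<in> permutations_of_set (S - {y})")
  case True
  then have q: "set q = S - {y}" and y: "y \<in> S" "y \<noteq> m"
    using assms by (auto simp: permutations_of_set_def)
  have p: "y # q \<in> permutations_of_set S"
    using True by (auto simp: permutations_of_set_def)
  consider "y < m" | "m < y" "\<forall>z\<in>S. z \<le> y" | z where "m < y" "z \<in> S" "y < z"
    using y by (meson not_le nat_neq_iff)
  then show ?thesis
  proof cases
    case 1
    then show ?thesis using True p by (auto simp: completions_def contains_123_Cons_Cons_less)
  next
    case 2
    then have "\<forall>z\<in>set q. z < y" using q by (auto simp: order.strict_iff_order)
    then show ?thesis using 2 True p by (auto simp: completions_def contains_123_Cons_Cons_max)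
  next
    case 3
    then show ?thesis
      using contains_123_Cons_Cons_greater[of m y z q] q leD by (auto simp: completions_def)
  qed
next
  case False
  then show ?thesis
    by (auto simp: completions_def permutations_of_set_def)
qed

text \<open>Here \<open>l\<close> is the latest letter: either the minimum \<open>m\<close> itself or, since the letters above the
  minimum occur in decreasing order, a letter larger than all of \<open>S\<close>.\<close>

definition wt :: "'a::comm_ring_1 \<Rightarrow> nat set \<Rightarrow> nat \<Rightarrow> nat \<Rightarrow> 'a" where
  "wt t S m l = (\<Sum>p\<in>completions S m. t ^ des (l # p))"

lemma wt_rec:
  assumes "finite S" "m \<notin> S" "S \<noteq> {}"
  shows "wt t S m l =
    (\<Sum>y\<in>{y\<in>S. y < m}. (if y < l then t else 1) * wt t (S - {y}) y y) +
    (if m < Max S then (if Max S < l then t else 1) * wt t (S - {Max S}) m (Max S) else 0)"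
proof -
  have sumC: "(\<Sum>p\<in>(#) y ` A. t ^ des (l # p)) = (if y < l then t else 1) * (\<Sum>p\<in>A. t ^ des (y # p))"
    for y A
    by (subst sum.reindex) (auto simp: des_Cons_Cons sum_distrib_left)
  define I where "I = {y\<in>S. y < m}"
  \<comment> \<open>Above the minimum only the largest remaining letter may come next, so there is
    at most one such block.\<close>
  define J where "J = (if m < Max S then (#) (Max S) ` completions (S - {Max S}) m else {})"
  have "completions S m = (\<Union>y\<in>I. (#) y ` completions (S - {y}) y) \<union> J" (is "?L = ?R")
  proof (intro set_eqI)
    fix p
    show "p \<in> ?L \<longleftrightarrow> p \<in> ?R"
    proof (cases p)
      case Nil
      then show ?thesis using assms by (auto simp: completions_def permutations_of_set_def J_def)
    next
      case (Cons y q)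
      have "(y \<in> S \<and> (\<forall>z\<in>S. z \<le> y)) \<longleftrightarrow> y = Max S"
        using assms by (metis Max_ge Max_in eq_Max_iff)
      then show ?thesis
        unfolding Cons Cons_in_completions[OF assms(1,2)] I_def J_def by auto
    qed
  qed
  moreover have "(\<Union>y\<in>I. (#) y ` completions (S - {y}) y) \<inter> J = {}"
    by (auto simp: I_def J_def)
  moreover have "finite J" "finite I"
    using assms by (auto simp: J_def I_def finite_completions)
  ultimately have "wt t S m l = (\<Sum>p\<in>(\<Union>y\<in>I. (#) y ` completions (S - {y}) y). t ^ des (l # p))
     + (\<Sum>p\<in>J. t ^ des (l # p))"
    unfolding wt_def using assms by (subst sum.union_disjoint[symmetric]) (auto simp: finite_completions)
  also have "(\<Sum>p\<in>(\<Union>y\<in>I. (#) y ` completions (S - {y}) y). t ^ des (l # p)) =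
      (\<Sum>y\<in>I. (if y < l then t else 1) * wt t (S - {y}) y y)"
    using \<open>finite I\<close> assms
    by (subst sum.UNION_disjoint) (auto simp: finite_completions sumC wt_def)
  also have "(\<Sum>p\<in>J. t ^ des (l # p)) =
     (if m < Max S then (if Max S < l then t else 1) * wt t (S - {Max S}) m (Max S) else 0)"
    by (simp add: J_def sumC wt_def)
  finally show ?thesis unfolding I_def .
qed

section \<open>From letter sets to the numbers of letters above and below the minimum\<close>

text \<open>Ranks in \<open>B\<close> take each value once. A new maximum has nothing above it and
  adds one greater element to every old member, so the induction shifts the first argument of
  \<open>f\<close>.\<close>

lemma sum_card_greater:
  fixes f :: "nat \<Rightarrow> nat \<Rightarrow> 'a::comm_monoid_add" and B :: "'b::linorder set"
  assumes "finite B"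
  shows "(\<Sum>y\<in>B. f (card {z\<in>B. y < z}) (card {z\<in>B. z < y})) = (\<Sum>i<card B. f i (card B - 1 - i))"
  using assms
proof (induction B arbitrary: f rule: finite_linorder_max_induct)
  case (insert b A)
  have "b \<notin> A" using insert.hyps by auto
  have 1: "{z \<in> insert b A. b < z} = {}" "{z \<in> insert b A. z < b} = A"
    using insert.hyps by auto
  have 2: "card {z \<in> insert b A. y < z} = Suc (card {z\<in>A. y < z})"
    "{z \<in> insert b A. z < y} = {z\<in>A. z < y}" if "y \<in> A" for y
  proof -
    have "{z \<in> insert b A. y < z} = insert b {z\<in>A. y < z}"
      using that insert.hyps by auto
    then show "card {z \<in> insert b A. y < z} = Suc (card {z\<in>A. y < z})"
      using insert.hyps \<open>b \<notin> A\<close> by simp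
    show "{z \<in> insert b A. z < y} = {z\<in>A. z < y}"
      using that insert.hyps by auto
  qed
  have "(\<Sum>y\<in>insert b A. f (card {z\<in>insert b A. y < z}) (card {z\<in>insert b A. z < y})) =
    f 0 (card A) + (\<Sum>y\<in>A. f (Suc (card {z\<in>A. y < z})) (card {z\<in>A. z < y}))"
    using insert.hyps(1) \<open>b \<notin> A\<close> by (simp add: 1 2 del: insert_iff)
  also have "\<dots> = f 0 (card A) + (\<Sum>i<card A. f (Suc i) (card A - 1 - i))"
    using insert.IH[of "\<lambda>i. f (Suc i)"] by simp
  also have "\<dots> = (\<Sum>i<card (insert b A). f i (card (insert b A) - 1 - i))"
    using insert.hyps \<open>b \<notin> A\<close> by (simp add: sum.lessThan_Suc_shift del: sum.lessThan_Suc)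
  finally show ?case .
qed simp

text \<open>The coefficients at \<open>X\<^sup>b\<close> are the weights of the completions with \<open>a\<close> letters above and \<open>b\<close> below
  the minimum, when the latest letter is not the minimum (\<open>desc_gf\<close>) or is the minimum (\<open>min_gf\<close>).
  \<open>tail_gf\<close> collects the completions that continue with a new minimum.\<close>

definition desc_gf :: "'a::comm_ring_1 \<Rightarrow> nat \<Rightarrow> 'a fps" where
  "desc_gf t a = lam t * nu t ^ a"

definition min_gf :: "'a::comm_ring_1 \<Rightarrow> nat \<Rightarrow> 'a fps" where
  "min_gf t a = (case a of 0 \<Rightarrow> lam t | Suc a' \<Rightarrow> mu t * nu t ^ a')"

definition tail_gf :: "'a::comm_ring_1 \<Rightarrow> nat \<Rightarrow> 'a fps" where
  "tail_gf t a = fps_X * (case a of 0 \<Rightarrow> lam t + fps_X * lam t * mu t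
                                  | Suc a' \<Rightarrow> lam t * mu t * nu t ^ a')"

text \<open>The new minimum is the largest letter below the old one, or that letter is skipped and
  from then on counts as lying above.\<close>

lemma tail_gf_rec: "tail_gf t a = fps_X * (min_gf t a + tail_gf t (Suc a))"
proof (cases a)
  case 0
  then show ?thesis by (simp add: tail_gf_def min_gf_def mult_ac)
next
  case (Suc b)
  have "lam t * mu t * nu t ^ b = (1 + fps_X * lam t * nu t) * (mu t * nu t ^ b)"
    using lam_eq_nu[of t] by (simp add: mult.assoc)
  also have "\<dots> = mu t * nu t ^ b + fps_X * (lam t * mu t * nu t ^ Suc b)"
    by (simp add: algebra_simps)
  finally show ?thesis unfolding Suc tail_gf_def min_gf_def nat.case by (rule arg_cong)
qed

lemma tail_gf_nth: "tail_gf t a $ b = (\<Sum>i<b. min_gf t (a + i) $ (b - 1 - i))"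
proof (induction b arbitrary: a)
  case 0
  show ?case by (simp add: tail_gf_def)
next
  case (Suc b)
  show ?case
    by (subst tail_gf_rec) (simp add: Suc sum.lessThan_Suc_shift del: sum.lessThan_Suc)
qed

lemma desc_gf_0: "desc_gf t 0 = 1 + fps_const t * tail_gf t 0"
  using lam_eq[of t] by (simp add: desc_gf_def tail_gf_def algebra_simps)

lemma min_gf_0: "min_gf t 0 = 1 + fps_const t * tail_gf t 0"
  using desc_gf_0[of t] by (simp add: desc_gf_def min_gf_def)

text \<open>Next comes the largest remaining letter, a descent since the latest letter exceeds it,
  or a new minimum. In \<open>min_gf_Suc\<close> the first option is an ascent and carries no
  \<open>t\<close>.\<close>

lemma desc_gf_Suc: "desc_gf t (Suc a) = fps_const t * desc_gf t a + fps_const t * tail_gf t (Suc a)"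
proof -
  have "lam t * nu t ^ a * nu t = lam t * nu t ^ a * (fps_const t + fps_const t * fps_X * mu t)"
    using nu_eq[of t] by simp
  then show ?thesis by (simp add: desc_gf_def tail_gf_def algebra_simps)
qed

lemma min_gf_Suc: "min_gf t (Suc a) = desc_gf t a + fps_const t * tail_gf t (Suc a)"
proof -
  have "mu t * nu t ^ a = (lam t + fps_const t * fps_X * lam t * mu t) * nu t ^ a"
    using mu_eq[of t] by simp
  then show ?thesis by (simp add: desc_gf_def min_gf_def tail_gf_def algebra_simps)
qed

text \<open>Both claims go through one strong induction: placing the largest letter leads to the
  second situation, a new minimum back to the first.\<close>

lemma wt_eq:
  assumes "finite S" "m \<notin> S"
  shows "wt t S m m = min_gf t (card {x\<in>S. m < x}) $ card {x\<in>S. x < m} \<and>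
    (\<forall>l. (\<forall>x\<in>S. x < l) \<longrightarrow> wt t S m l = desc_gf t (card {x\<in>S. m < x}) $ card {x\<in>S. x < m})"
  using assms
proof (induction "card S" arbitrary: S m rule: less_induct)
  case less
  show ?case
  proof (cases "S = {}")
    case True
    then show ?thesis
      by (simp add: wt_def completions_empty des_singleton min_gf_0 desc_gf_0 tail_gf_def)
  next
    case False
    note fin = \<open>finite S\<close>
    define a b where "a = card {x\<in>S. m < x}" and "b = card {x\<in>S. x < m}"
    have lower: "(\<Sum>y\<in>{y\<in>S. y < m}. wt t (S - {y}) y y) = tail_gf t a $ b"
    proof -
      \<comment> \<open>The letters above the new minimum \<open>y\<close> are those above
        \<open>m\<close> and the skipped ones between \<open>y\<close> and \<open>m\<close>.\<close>
      have "wt t (S - {y}) y y = min_gf t (a + card {z\<in>{y\<in>S. y < m}. y < z}) $ card {z\<in>{y\<in>S. y < m}. z < y}"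
        if y: "y \<in> S" "y < m" for y
      proof -
        have "{x \<in> S - {y}. y < x} = {x\<in>S. m < x} \<union> {z\<in>{y\<in>S. y < m}. y < z}"
          using y less.prems(2) by (auto simp: not_less_iff_gr_or_eq)
        then have "card {x \<in> S - {y}. y < x} = a + card {z\<in>{y\<in>S. y < m}. y < z}"
          unfolding a_def using fin card_Un_disjoint[of "{x\<in>S. m < x}" "{z\<in>{y\<in>S. y < m}. y < z}"]
          by fastforce
        moreover have "{x \<in> S - {y}. x < y} = {z\<in>{y\<in>S. y < m}. z < y}"
          using y by auto
        moreover have "card (S - {y}) < card S"
          using fin y(1) by (rule card_Diff1_less)
        ultimately show ?thesis
          using less.hyps[of "S - {y}" y] fin by simp
      qed
      then have "(\<Sum>y\<in>{y\<in>S. y < m}. wt t (S - {y}) y y) =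
        (\<Sum>y\<in>{y\<in>S. y < m}. min_gf t (a + card {z\<in>{y\<in>S. y < m}. y < z}) $ card {z\<in>{y\<in>S. y < m}. z < y})"
        by (intro sum.cong) auto
      also have "\<dots> = tail_gf t a $ b"
        using sum_card_greater[of "{y\<in>S. y < m}" "\<lambda>i j. min_gf t (a + i) $ j"] fin
        unfolding tail_gf_nth b_def by simp
      finally show ?thesis .
    qed
    \<comment> \<open>The condition on \<open>l\<close> makes every step to a new minimum a
      descent.\<close>
    have rec: "wt t S m l = t * tail_gf t a $ b +
      (if m < Max S then (if Max S < l then t else 1) * wt t (S - {Max S}) m (Max S) else 0)"
      if "\<forall>y\<in>S. y < m \<longrightarrow> y < l" for l
    proof -
      have "(\<Sum>y\<in>{y\<in>S. y < m}. (if y < l then t else 1) * wt t (S - {y}) y y) = t * tail_gf t a $ b"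
        unfolding lower[symmetric] sum_distrib_left using that by (intro sum.cong) auto
      then show ?thesis
        using wt_rec[OF fin less.prems(2) False, of t l] by simp
    qed
    show ?thesis
    proof (cases "m < Max S")
      case True
      define M where "M = Max S"
      have M: "M \<in> S" "m < M" "\<forall>x\<in>S. x \<le> M"
        using True fin False by (auto simp: M_def)
      have "{x\<in>S. m < x} = insert M {x\<in>S - {M}. m < x}" using M by auto
      then have a: "a = Suc (card {x\<in>S - {M}. m < x})"
        unfolding a_def using fin by simp
      have b: "{x\<in>S - {M}. x < m} = {x\<in>S. x < m}" using M by auto
      have "card (S - {M}) < card S"
        using fin M(1) by (rule card_Diff1_less)
      moreover have "\<forall>x\<in>S - {M}. x < M" using M by (auto simp: order.strict_iff_order)
      ultimately have w: "wt t (S - {M}) m M = desc_gf t (a - 1) $ b"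
        using less.hyps[of "S - {M}" m] fin less.prems(2) a b unfolding b_def by auto
      have "wt t S m m = min_gf t a $ b"
        using rec[of m] True w a unfolding M_def by (simp add: min_gf_Suc)
      moreover have "wt t S m l = desc_gf t a $ b" if l: "\<forall>x\<in>S. x < l" for l
        using rec[of l] True w a l M unfolding M_def by (simp add: desc_gf_Suc)
      ultimately show ?thesis unfolding a_def b_def by blast
    next
      case nM: False
      have le: "\<forall>x\<in>S. x < m"
        using nM less.prems False by (metis Max_ge le_neq_implies_less not_less order_trans)
      then have a: "a = 0" unfolding a_def using fin by auto
      have "{x\<in>S. x < m} = S" using le by auto
      \<comment> \<open>The constant 1 in \<open>min_gf_0\<close> and \<open>desc_gf_0\<close>
        accounts for the empty completion only, so it vanishes here.\<close>
      then have b: "b \<noteq> 0" unfolding b_def using fin False by simp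
      have "wt t S m m = min_gf t a $ b"
        using rec[of m] nM a b by (simp add: min_gf_0)
      moreover have "wt t S m l = desc_gf t a $ b" if l: "\<forall>x\<in>S. x < l" for l
        using rec[of l] nM a b l by (simp add: desc_gf_0)
      ultimately show ?thesis unfolding a_def b_def by blast
    qed
  qed
qed

text \<open>An artificial first letter \<open>Suc n\<close> serves as the initial minimum. It starts
  no pattern and adds exactly one descent, which is the extra factor \<open>t\<close>.\<close>

lemma perms_gf:
  assumes "n \<ge> 1"
  shows "(\<Sum>p\<in>perms_avoiding_123 n. t ^ Suc (des p)) = lam t $ n"
proof -
  have nasc: "\<not> asc_above (Suc n) p" if "set p = {1..n}" for p
  proof
    assume "asc_above (Suc n) p"
    then obtain j k where "j < k" "k < length p" "Suc n < p ! j"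
      by (auto simp: asc_above_def)
    moreover have "p ! j \<in> set p" using calculation by simp
    ultimately show False using that by auto
  qed
  have "perms_avoiding_123 n = completions {1..n} (Suc n)"
    by (auto simp: perms_avoiding_123_def completions_def contains_123_Cons nasc permutations_of_set_def)
  moreover have "des (Suc n # p) = Suc (des p)" if "p \<in> completions {1..n} (Suc n)" for p
  proof (cases p)
    case Nil
    then show ?thesis using that assms by (auto simp: completions_def permutations_of_set_def)
  next
    case (Cons y q)
    then have "y \<in> {1..n}" using that by (auto simp: completions_def permutations_of_set_def)
    then show ?thesis by (simp add: Cons des_Cons_Cons)
  qed
  ultimately have "(\<Sum>p\<in>perms_avoiding_123 n. t ^ Suc (des p)) = wt t {1..n} (Suc n) (Suc n)"
    unfolding wt_def by (intro sum.cong) auto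
  also have "\<dots> = min_gf t (card {x\<in>{1..n}. Suc n < x}) $ card {x\<in>{1..n}. x < Suc n}"
    using wt_eq[of "{1..n}" "Suc n" t] by simp
  also have "{x\<in>{1..n}. Suc n < x} = {}" by auto
  also have "{x\<in>{1..n}. x < Suc n} = {1..n}" by auto
  finally show ?thesis by (simp add: min_gf_def)
qed


subsection \<open>Inversion sequences\<close>

text \<open>The weight of all extensions of \<open>e\<close> by \<open>r\<close> entries is the coefficient at \<open>X\<^sup>r\<close> of
  \<open>reset_gf t A + (k + t s) slope_gf t A\<close> with \<open>A = length e + 1 - U\<close>.\<close>

definition reset_gf :: "'a::comm_ring_1 \<Rightarrow> nat \<Rightarrow> 'a fps" where
  "reset_gf t A = lam t * (mu t ^ (A - 1) - fps_const t * fps_X * (\<Sum>j=1..<A. mu t ^ j))"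

definition slope_gf :: "'a::comm_ring_1 \<Rightarrow> nat \<Rightarrow> 'a fps" where
  "slope_gf t A = fps_X * lam t * mu t ^ A"

text \<open>The terms proportional to \<open>k + t s\<close> when one entry is read: a record keeps
  them with a factor \<open>t\<close>, and a value in \<open>{L..<U}\<close> leads to
  \<open>reset_gf\<close> at \<open>Suc A\<close>. The subtracted sum in \<open>reset_gf\<close>
  cancels the record terms.\<close>

lemma slope_gf_rec:
  "slope_gf t A = fps_X * (fps_const t * (\<Sum>B=1..A. slope_gf t B) + reset_gf t (Suc A))"
proof -
  have "(\<Sum>B=1..A. slope_gf t B) = fps_X * lam t * (\<Sum>B=1..A. mu t ^ B)"
    by (simp add: slope_gf_def sum_distrib_left)
  moreover have "{1..<Suc A} = {1..A}" by auto
  ultimately show ?thesis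
    by (simp add: reset_gf_def slope_gf_def algebra_simps)
qed

lemma reset_gf_rec:
  assumes "A \<ge> 1"
  shows "reset_gf t A = 1 + fps_X * (fps_const t *
    (\<Sum>B=1..A. reset_gf t B + (1 + fps_const t * of_nat (A - B)) * slope_gf t B))"
  using assms
proof (induction A rule: dec_induct)
  case base
  show ?case
    using lam_eq[of t] by (simp add: reset_gf_def slope_gf_def algebra_simps)
next
  case (step A)
  define c where "c = fps_const t"
  define P where "P = (\<Sum>j=1..A. mu t ^ j)"
  have I: "{1..<Suc A} = {1..A}" by auto
  obtain A' where A': "A = Suc A'" using step.hyps by (cases A) auto
  have slopes: "(\<Sum>B=1..A. slope_gf t B) = fps_X * lam t * P"
    by (simp add: slope_gf_def P_def sum_distrib_left)
  have "(\<Sum>B=1..Suc A. reset_gf t B + (1 + c * of_nat (Suc A - B)) * slope_gf t B) =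
    (\<Sum>B=1..A. reset_gf t B + (1 + c * of_nat (Suc A - B)) * slope_gf t B)
      + reset_gf t (Suc A) + slope_gf t (Suc A)"
    by (simp add: algebra_simps)
  \<comment> \<open>Every \<open>A - B\<close> grows by one, which adds \<open>c\<close> times each
    slope.\<close>
  also have "(\<Sum>B=1..A. reset_gf t B + (1 + c * of_nat (Suc A - B)) * slope_gf t B) =
     (\<Sum>B=1..A. (reset_gf t B + (1 + c * of_nat (A - B)) * slope_gf t B) + c * slope_gf t B)"
    by (intro sum.cong) (auto simp: Suc_diff_le algebra_simps)
  also have "\<dots> = (\<Sum>B=1..A. reset_gf t B + (1 + c * of_nat (A - B)) * slope_gf t B) + c * (fps_X * lam t * P)"
    by (simp only: sum.distrib sum_distrib_left[symmetric] slopes)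
  finally have "1 + fps_X * (c * (\<Sum>B=1..Suc A. reset_gf t B + (1 + c * of_nat (Suc A - B)) * slope_gf t B)) =
    reset_gf t A + fps_X * c * (c * (fps_X * lam t * P) + reset_gf t (Suc A) + slope_gf t (Suc A))"
    unfolding step.IH c_def by (simp only: algebra_simps)
  also have "c * (fps_X * lam t * P) + reset_gf t (Suc A) + slope_gf t (Suc A) =
      lam t * mu t ^ A * (1 + fps_X * mu t)"
    unfolding reset_gf_def slope_gf_def I P_def[symmetric] c_def[symmetric] by (simp add: algebra_simps)
  also have "reset_gf t A = reset_gf t (Suc A) - lam t * (mu t ^ A' * (mu t - 1 - c * fps_X * mu t))"
    by (simp add: reset_gf_def A' c_def[symmetric] algebra_simps)
  \<comment> \<open>The quadratic of \<mu> is the kernel equation that makes the increments of both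
    sides agree.\<close>
  also have "mu t - 1 - c * fps_X * mu t = c * fps_X * mu t * (1 + fps_X * mu t)"
    using mu_quadratic[of t] unfolding c_def by (simp add: algebra_simps power2_eq_square)
  finally show ?case
    unfolding c_def by (simp add: A' algebra_simps)
qed

section \<open>Appending one entry to an avoiding inversion sequence\<close>

definition extensions :: "nat list \<Rightarrow> nat \<Rightarrow> nat list set" where
  "extensions e r = {q. e @ q \<in> inv_seqs_avoiding_ge_any_ge (length e + r)}"

lemma contains_ge_any_ge_snoc:
  "contains_ge_any_ge (e @ [x]) \<longleftrightarrow> contains_ge_any_ge e \<or>
     (\<exists>i j. i < j \<and> j < length e \<and> e ! i \<ge> e ! j \<and> e ! i \<ge> x)"
proof
  assume "contains_ge_any_ge (e @ [x])"
  then obtain i j k where ijk: "i < j" "j < k" "k < length (e @ [x])"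
    "(e @ [x]) ! i \<ge> (e @ [x]) ! j" "(e @ [x]) ! i \<ge> (e @ [x]) ! k"
    by (auto simp: contains_ge_any_ge_def)
  show "contains_ge_any_ge e \<or> (\<exists>i j. i < j \<and> j < length e \<and> e ! i \<ge> e ! j \<and> e ! i \<ge> x)"
  proof (cases "k < length e")
    case True
    then have "contains_ge_any_ge e"
      using ijk unfolding contains_ge_any_ge_def by (intro exI[of _ i] exI[of _ j] exI[of _ k]) (auto simp: nth_append)
    then show ?thesis ..
  next
    case False
    then have "k = length e" using ijk by simp
    then have "i < j \<and> j < length e \<and> e ! i \<ge> e ! j \<and> e ! i \<ge> x"
      using ijk by (auto simp: nth_append)
    then show ?thesis by blast
  qed
next
  assume "contains_ge_any_ge e \<or> (\<exists>i j. i < j \<and> j < length e \<and> e ! i \<ge> e ! j \<and> e ! i \<ge> x)"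
  then show "contains_ge_any_ge (e @ [x])"
  proof (elim disjE exE conjE)
    assume "contains_ge_any_ge e"
    then obtain i j k where "i < j" "j < k" "k < length e" "e ! i \<ge> e ! j" "e ! i \<ge> e ! k"
      by (auto simp: contains_ge_any_ge_def)
    then show ?thesis
      unfolding contains_ge_any_ge_def by (intro exI[of _ i] exI[of _ j] exI[of _ k]) (auto simp: nth_append)
  next
    fix i j assume "i < j" "j < length e" "e ! i \<ge> e ! j" "e ! i \<ge> x"
    then show ?thesis
      unfolding contains_ge_any_ge_def
      by (intro exI[of _ i] exI[of _ j] exI[of _ "length e"]) (auto simp: nth_append)
  qed
qed

lemma contains_ge_any_ge_append: "contains_ge_any_ge e \<Longrightarrow> contains_ge_any_ge (e @ q)"
  by (induction q rule: rev_induct) (auto simp: contains_ge_any_ge_snoc simp flip: append_assoc)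

lemma inv_seqs_avoiding_append:
  "e @ q \<in> inv_seqs_avoiding_ge_any_ge (length e + r) \<Longrightarrow> e \<in> inv_seqs_avoiding_ge_any_ge (length e)"
  using contains_ge_any_ge_append[of e q]
  by (auto simp: inv_seqs_avoiding_ge_any_ge_def inv_seqs_def nth_append split: if_splits)

text \<open>\<open>L\<close> and \<open>U\<close> are shifted by one so that both are \<open>0\<close> for the empty sequence.\<close>

definition thresholds :: "nat list \<Rightarrow> nat \<Rightarrow> nat \<Rightarrow> bool" where
  "thresholds e L U \<longleftrightarrow>
     e \<in> inv_seqs_avoiding_ge_any_ge (length e) \<and> L \<le> U \<and> U \<le> length e \<and>
     (\<forall>x\<in>set e. x < U) \<and> (U > 0 \<longrightarrow> U - 1 \<in> set e) \<and>
     (\<forall>i j. i < j \<longrightarrow> j < length e \<longrightarrow> e ! i \<ge> e ! j \<longrightarrow> e ! i < L) \<and>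
     (L > 0 \<longrightarrow> (\<exists>i j. i < j \<and> j < length e \<and> e ! i \<ge> e ! j \<and> e ! i = L - 1))"

lemma thresholdsD:
  assumes "thresholds e L U"
  shows "e \<in> inv_seqs_avoiding_ge_any_ge (length e)" "L \<le> U" "U \<le> length e"
    "\<And>x. x \<in> set e \<Longrightarrow> x < U" "U > 0 \<Longrightarrow> U - 1 \<in> set e"
    "\<And>i j. i < j \<Longrightarrow> j < length e \<Longrightarrow> e ! i \<ge> e ! j \<Longrightarrow> e ! i < L"
    "L > 0 \<Longrightarrow> \<exists>i j. i < j \<and> j < length e \<and> e ! i \<ge> e ! j \<and> e ! i = L - 1"
  using assms unfolding thresholds_def by simp_all

lemma thresholds_Nil: "thresholds [] 0 0"
  by (auto simp: thresholds_def inv_seqs_avoiding_ge_any_ge_def inv_seqs_def contains_ge_any_ge_def)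

text \<open>A new entry can only be the last of a pattern, and it completes one iff it is at most
  \<open>L - 1\<close>, the largest entry already followed by one that is not larger.\<close>

lemma snoc_avoiding_iff:
  assumes "thresholds e L U"
  shows "e @ [x] \<in> inv_seqs_avoiding_ge_any_ge (Suc (length e)) \<longleftrightarrow> L \<le> x \<and> x \<le> length e"
proof -
  have "(\<exists>i j. i < j \<and> j < length e \<and> e ! i \<ge> e ! j \<and> e ! i \<ge> x) \<longleftrightarrow> x < L"
  proof
    assume "\<exists>i j. i < j \<and> j < length e \<and> e ! i \<ge> e ! j \<and> e ! i \<ge> x"
    then show "x < L" using thresholdsD(6)[OF assms] by (meson le_less_trans)
  next
    assume "x < L"
    then obtain i j where "i < j" "j < length e" "e ! i \<ge> e ! j" "e ! i = L - 1"
      using thresholdsD(7)[OF assms] by auto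
    then show "\<exists>i j. i < j \<and> j < length e \<and> e ! i \<ge> e ! j \<and> e ! i \<ge> x"
      using \<open>x < L\<close> by (intro exI[of _ i] exI[of _ j]) auto
  qed
  moreover have "e \<in> inv_seqs_avoiding_ge_any_ge (length e)"
    by (rule thresholdsD(1)[OF assms])
  ultimately show ?thesis
    by (auto simp: inv_seqs_avoiding_ge_any_ge_def inv_seqs_def contains_ge_any_ge_snoc nth_append less_Suc_eq)
qed

text \<open>All entries of \<open>e\<close> are below \<open>x\<close>, so no further entry acquires
  a successor that is not larger, and \<open>L\<close> stays.\<close>

lemma thresholds_snoc_record:
  assumes th: "thresholds e L U" and x: "U \<le> x" "x \<le> length e"
  shows "thresholds (e @ [x]) L (Suc x)"
proof -
  have av: "e @ [x] \<in> inv_seqs_avoiding_ge_any_ge (Suc (length e))"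
    using snoc_avoiding_iff[OF th] x thresholdsD(2,3)[OF th] by auto
  have lt: "\<forall>y\<in>set e. y < x" using thresholdsD(4)[OF th] x by fastforce
  have up: "(e @ [x]) ! i < L" if "i < j" "j < length (e @ [x])" "(e @ [x]) ! i \<ge> (e @ [x]) ! j" for i j
  proof (cases "j < length e")
    case True
    then show ?thesis using that thresholdsD(6)[OF th, of i j] by (simp add: nth_append)
  next
    case False
    then have "j = length e" using that by simp
    then have "e ! i \<ge> x" "e ! i \<in> set e" using that by (auto simp: nth_append)
    then show ?thesis using lt by auto
  qed
  have ex: "\<exists>i j. i < j \<and> j < length (e @ [x]) \<and> (e @ [x]) ! i \<ge> (e @ [x]) ! j \<and> (e @ [x]) ! i = L - 1"
    if L: "L > 0"
  proof -
    obtain i j where "i < j" "j < length e" "e ! i \<ge> e ! j" "e ! i = L - 1"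
      using thresholdsD(7)[OF th L] by blast
    then show ?thesis by (intro exI[of _ i] exI[of _ j]) (auto simp: nth_append)
  qed
  show ?thesis
    unfolding thresholds_def
  proof (intro conjI allI impI)
    show "L \<le> Suc x" using thresholdsD(2)[OF th] x by simp
  qed (use av lt up ex x in \<open>auto simp: less_Suc_eq\<close>)
qed

text \<open>Now the maximum \<open>U - 1\<close> itself is followed by an entry that is not
  larger.\<close>

lemma thresholds_snoc_nonrecord:
  assumes th: "thresholds e L U" and x: "L \<le> x" "x < U"
  shows "thresholds (e @ [x]) U U"
proof -
  have av: "e @ [x] \<in> inv_seqs_avoiding_ge_any_ge (Suc (length e))"
    using snoc_avoiding_iff[OF th] x thresholdsD(2,3)[OF th] by auto
  have lt: "\<forall>y\<in>set (e @ [x]). y < U" using thresholdsD(4)[OF th] x by auto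
  have up: "(e @ [x]) ! i < U" if "i < j" "j < length (e @ [x])" for i j
    using lt that by (meson nth_mem order_less_trans)
  have ex: "\<exists>i j. i < j \<and> j < length (e @ [x]) \<and> (e @ [x]) ! i \<ge> (e @ [x]) ! j \<and> (e @ [x]) ! i = U - 1"
  proof -
    have "U - 1 \<in> set e" using thresholdsD(5)[OF th] x by simp
    then obtain i where "i < length e" "e ! i = U - 1" by (auto simp: in_set_conv_nth)
    then show ?thesis using x by (intro exI[of _ i] exI[of _ "length e"]) (auto simp: nth_append)
  qed
  show ?thesis
    unfolding thresholds_def
  proof (intro conjI allI impI)
    show "U \<le> length (e @ [x])" using thresholdsD(3)[OF th] by simp
    show "U - 1 \<in> set (e @ [x])" using thresholdsD(5)[OF th] x by simp
  qed (use av lt up ex in auto)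
qed

lemma finite_extensions: "finite (extensions e r)"
proof (rule finite_subset)
  show "extensions e r \<subseteq> {q. set q \<subseteq> {..length e + r} \<and> length q = r}"
  proof
    fix q assume "q \<in> extensions e r"
    then have q: "length q = r" "\<forall>i<length e + r. (e @ q) ! i < Suc i"
      by (auto simp: extensions_def inv_seqs_avoiding_ge_any_ge_def inv_seqs_def)
    have "y \<le> length e + r" if y: "y \<in> set q" for y
    proof -
      obtain i where "i < r" "y = q ! i" using y unfolding in_set_conv_nth q(1) by blast
      then show ?thesis using q(2)[rule_format, of "length e + i"] by (simp add: nth_append)
    qed
    then show "q \<in> {q. set q \<subseteq> {..length e + r} \<and> length q = r}" using q by auto
  qed
  show "finite {q. set q \<subseteq> {..length e + r} \<and> length q = r}"
    by (rule finite_lists_length_eq) simp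
qed

lemma extensions_Suc:
  assumes "thresholds e L U"
  shows "extensions e (Suc r) = (\<Union>x\<in>{L..length e}. (#) x ` extensions (e @ [x]) r)"
proof (intro set_eqI)
  fix q
  show "q \<in> extensions e (Suc r) \<longleftrightarrow> q \<in> (\<Union>x\<in>{L..length e}. (#) x ` extensions (e @ [x]) r)"
  proof (cases q)
    case Nil
    then show ?thesis
      by (auto simp: extensions_def inv_seqs_avoiding_ge_any_ge_def inv_seqs_def)
  next
    case (Cons x p)
    have "x \<in> {L..length e}" if "x # p \<in> extensions e (Suc r)"
      using that inv_seqs_avoiding_append[of "e @ [x]" p r] snoc_avoiding_iff[OF assms, of x]
      by (simp add: extensions_def)
    then show ?thesis
      by (auto simp: Cons extensions_def)
  qed
qed

section \<open>Weights of extensions and the comparison of both sides\<close>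

text \<open>Only values new to \<open>e\<close> count, so the weight factors entry by entry.\<close>

definition ext_wt :: "'a::comm_ring_1 \<Rightarrow> nat list \<Rightarrow> nat \<Rightarrow> 'a" where
  "ext_wt t e r = (\<Sum>q\<in>extensions e r. t ^ card (set q - set e))"

lemma ext_wt_Suc:
  assumes "thresholds e L U"
  shows "ext_wt t e (Suc r) = (\<Sum>x=L..length e. (if x \<in> set e then 1 else t) * ext_wt t (e @ [x]) r)"
proof -
  have card: "card (set (x # q) - set e) = (if x \<in> set e then 0 else 1) + card (set q - set (e @ [x]))" for x q
  proof -
    have "set (x # q) - set e = (if x \<in> set e then {} else {x}) \<union> (set q - set (e @ [x]))" by auto
    then show ?thesis by (auto simp: card_insert_if)
  qed
  have "(\<Sum>q\<in>(#) x ` extensions (e @ [x]) r. t ^ card (set q - set e)) =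
    (if x \<in> set e then 1 else t) * ext_wt t (e @ [x]) r" for x
    unfolding ext_wt_def sum_distrib_left
    by (subst sum.reindex) (auto simp: card simp del: set_simps set_append)
  then show ?thesis
    unfolding ext_wt_def[of t e] extensions_Suc[OF assms]
    by (subst sum.UNION_disjoint) (auto simp: finite_extensions)
qed

lemma ext_wt_eq:
  assumes "thresholds e L U"
  defines "k \<equiv> card (set e \<inter> {L..<U})"
  shows "ext_wt t e r = reset_gf t (Suc (length e) - U) $ r +
    (of_nat k + t * of_nat (U - L - k)) * slope_gf t (Suc (length e) - U) $ r"
  using assms(1) unfolding k_def
proof (induction r arbitrary: e L U)
  case 0
  have "extensions e 0 = {[]}"
    using thresholdsD(1)[OF 0]
    by (auto simp: extensions_def inv_seqs_avoiding_ge_any_ge_def inv_seqs_def)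
  moreover have "reset_gf t A $ 0 = 1" if "A \<ge> 1" for A
    using that by (subst reset_gf_rec) auto
  moreover have "slope_gf t A $ 0 = 0" for A
    by (simp add: slope_gf_def)
  moreover have "Suc (length e) - U \<ge> 1"
    using thresholdsD(3)[OF 0] by simp
  ultimately show ?case by (simp add: ext_wt_def)
next
  case (Suc r)
  note th = Suc.prems
  define n where "n = length e"
  define A where "A = Suc n - U"
  define K where "K = set e \<inter> {L..<U}"
  define k where "k = card K"
  define s where "s = U - L - k"
  have LU: "L \<le> U" "U \<le> n" "\<forall>x\<in>set e. x < U"
    using thresholdsD(2-4)[OF th] by (auto simp: n_def)
  have A1: "A \<ge> 1" "A = Suc (n - U)" using LU by (auto simp: A_def)
  have fK: "finite K" by (simp add: K_def)
  have kle: "k \<le> U - L" unfolding k_def K_def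
    using card_mono[of "{L..<U}" "set e \<inter> {L..<U}"] by simp
  have "ext_wt t e (Suc r) = (\<Sum>x=L..n. (if x \<in> set e then 1 else t) * ext_wt t (e @ [x]) r)"
    unfolding n_def by (rule ext_wt_Suc[OF th])
  also have "{L..n} = {L..<U} \<union> {U..n}" using LU by auto
  also have "(\<Sum>x\<in>{L..<U} \<union> {U..n}. (if x \<in> set e then 1 else t) * ext_wt t (e @ [x]) r) =
     (\<Sum>x\<in>{L..<U}. (if x \<in> set e then 1 else t) * ext_wt t (e @ [x]) r) +
     (\<Sum>x\<in>{U..n}. (if x \<in> set e then 1 else t) * ext_wt t (e @ [x]) r)"
    by (rule sum.union_disjoint) auto
  \<comment> \<open>After a non-record the window is \<open>{U..<U}\<close>, so the slope term
    vanishes; \<open>A\<close> rises by one with the length.\<close>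
  also have "(\<Sum>x\<in>{L..<U}. (if x \<in> set e then 1 else t) * ext_wt t (e @ [x]) r) =
     (\<Sum>x\<in>{L..<U}. (if x \<in> set e then 1 else t) * reset_gf t (Suc A) $ r)"
  proof (rule sum.cong)
    fix x assume "x \<in> {L..<U}"
    then have "thresholds (e @ [x]) U U" using thresholds_snoc_nonrecord[OF th] by auto
    from Suc.IH[OF this] have "ext_wt t (e @ [x]) r = reset_gf t (Suc A) $ r"
      using LU by (simp add: A_def n_def Suc_diff_le)
    then show "(if x \<in> set e then 1 else t) * ext_wt t (e @ [x]) r = (if x \<in> set e then 1 else t) * reset_gf t (Suc A) $ r"
      by simp
  qed simp
  also have "\<dots> = (of_nat k + t * of_nat s) * reset_gf t (Suc A) $ r"
  proof -
    have "(\<Sum>x\<in>{L..<U}. (if x \<in> set e then 1 else t)) = (\<Sum>x\<in>K. 1) + (\<Sum>x\<in>{L..<U} - K. t)"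
    proof -
      have "{L..<U} = K \<union> ({L..<U} - K)" by (auto simp: K_def)
      then have "(\<Sum>x\<in>{L..<U}. (if x \<in> set e then 1 else t)) =
          (\<Sum>x\<in>K \<union> ({L..<U} - K). (if x \<in> set e then 1 else t))"
        by simp
      also have "\<dots> = (\<Sum>x\<in>K. if x \<in> set e then 1 else t) + (\<Sum>x\<in>{L..<U} - K. if x \<in> set e then 1 else t)"
        using fK by (intro sum.union_disjoint) auto
      also have "\<dots> = (\<Sum>x\<in>K. 1) + (\<Sum>x\<in>{L..<U} - K. t)"
        by (intro arg_cong2[of _ _ _ _ "(+)"] sum.cong) (auto simp: K_def)
      finally show ?thesis .
    qed
    also have "\<dots> = of_nat k + t * of_nat s"
      using fK by (simp add: k_def s_def card_Diff_subset K_def mult.commute)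
    finally show ?thesis by (simp add: sum_distrib_right[symmetric])
  qed
  also have "(\<Sum>x\<in>{U..n}. (if x \<in> set e then 1 else t) * ext_wt t (e @ [x]) r) =
    (\<Sum>x\<in>{U..n}. t * (reset_gf t (Suc n - x) $ r +
       (of_nat (Suc k) + t * of_nat (s + (x - U))) * slope_gf t (Suc n - x) $ r))"
  proof (rule sum.cong)
    fix x assume x: "x \<in> {U..n}"
    then have "thresholds (e @ [x]) L (Suc x)" using thresholds_snoc_record[OF th] by (auto simp: n_def)
    note IH = Suc.IH[OF this]
    have "x \<notin> set e" using LU x by auto
    have "set (e @ [x]) \<inter> {L..<Suc x} = insert x K"
      using LU x by (auto simp: K_def)
    moreover have "card (insert x K) = Suc k"
      using fK \<open>x \<notin> set e\<close> by (simp add: k_def K_def)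
    ultimately have "card (set (e @ [x]) \<inter> {L..<Suc x}) = Suc k" by simp
    moreover have "Suc x - L - Suc k = s + (x - U)"
      using kle LU x by (auto simp: s_def)
    ultimately have "ext_wt t (e @ [x]) r = reset_gf t (Suc n - x) $ r +
       (of_nat (Suc k) + t * of_nat (s + (x - U))) * slope_gf t (Suc n - x) $ r"
      using IH by (simp add: n_def)
    then show "(if x \<in> set e then 1 else t) * ext_wt t (e @ [x]) r = t * (reset_gf t (Suc n - x) $ r +
       (of_nat (Suc k) + t * of_nat (s + (x - U))) * slope_gf t (Suc n - x) $ r)"
      using \<open>x \<notin> set e\<close> by simp
  qed simp
  \<comment> \<open>Substitution \<open>B = Suc n - x\<close>, under which \<open>x - U\<close>
    becomes \<open>A - B\<close>.\<close>
  also have "\<dots> = (\<Sum>B=1..A. t * (reset_gf t B $ r +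
       (of_nat (Suc k) + t * of_nat (s + (A - B))) * slope_gf t B $ r))"
    using LU by (intro sum.reindex_bij_witness[of _ "\<lambda>B. Suc n - B" "\<lambda>x. Suc n - x"]) (auto simp: A_def)
  also have "\<dots> = t * (\<Sum>B=1..A. reset_gf t B $ r + (1 + t * of_nat (A - B)) * slope_gf t B $ r) +
     (of_nat k + t * of_nat s) * (t * (\<Sum>B=1..A. slope_gf t B $ r))"
    by (simp add: sum_distrib_left sum.distrib[symmetric] algebra_simps)
  also have "t * (\<Sum>B=1..A. reset_gf t B $ r + (1 + t * of_nat (A - B)) * slope_gf t B $ r) = reset_gf t A $ Suc r"
  proof -
    have "((1 + fps_const t * of_nat j) * f) $ r = (1 + t * of_nat j) * f $ r" for j and f :: "'a fps"
    proof -
      have "(1 + fps_const t * of_nat j) = fps_const (1 + t * of_nat j)"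
        by (intro fps_ext) (simp add: fps_of_nat[symmetric])
      then show ?thesis by simp
    qed
    then show ?thesis
      by (subst reset_gf_rec[OF A1(1)]) (simp add: fps_sum_nth del: of_nat_diff)
  qed
  finally have "ext_wt t e (Suc r) = reset_gf t A $ Suc r +
    (of_nat k + t * of_nat s) * (t * (\<Sum>B=1..A. slope_gf t B $ r) + reset_gf t (Suc A) $ r)"
    by (simp add: algebra_simps)
  also have "t * (\<Sum>B=1..A. slope_gf t B $ r) + reset_gf t (Suc A) $ r = slope_gf t A $ Suc r"
    by (subst (2) slope_gf_rec) (simp add: fps_sum_nth)
  finally show ?case by (simp add: A_def n_def s_def k_def K_def)
qed

text \<open>The first entry is 0, so \<open>Suc (dist_pos e)\<close> counts all distinct values. For
  the empty prefix \<open>A = 1\<close> and the window is empty, which leaves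
  \<open>reset_gf t 1\<close>, that is \<lambda>.\<close>

lemma inv_seqs_gf:
  assumes "n \<ge> 1"
  shows "(\<Sum>e\<in>inv_seqs_avoiding_ge_any_ge n. t ^ Suc (dist_pos e)) = lam t $ n"
proof -
  have "Suc (dist_pos e) = card (set e)" if "e \<in> inv_seqs_avoiding_ge_any_ge n" for e
  proof -
    have "e ! 0 < Suc 0" "0 < length e"
      using that assms by (auto simp: inv_seqs_avoiding_ge_any_ge_def inv_seqs_def Suc_le_eq)
    then have "0 \<in> set e" by (metis nth_mem less_Suc0)
    then have "set e = insert 0 {x \<in> set e. x > 0}" by auto
    then have "card (set e) = card (insert 0 {x \<in> set e. x > 0})" by simp
    then show ?thesis by (simp add: dist_pos_def)
  qed
  then have "(\<Sum>e\<in>inv_seqs_avoiding_ge_any_ge n. t ^ Suc (dist_pos e)) = ext_wt t [] n"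
    unfolding ext_wt_def by (intro sum.cong) (auto simp: extensions_def)
  also have "\<dots> = lam t $ n"
    using ext_wt_eq[OF thresholds_Nil, of t n] by (simp add: reset_gf_def)
  finally show ?thesis .
qed

theorem theorem2p2:
  fixes n :: nat
  assumes "n \<ge> 1"
  shows "(\<Sum>p\<in>perms_avoiding_123 n. monom (1::int) (des p)) =
         (\<Sum>e\<in>inv_seqs_avoiding_ge_any_ge n. monom (1::int) (dist_pos e))"
proof -
  \<comment> \<open>The series identities are used at the polynomial variable, where the common
    factor \<open>t\<close> can be cancelled.\<close>
  define t where "t = monom (1::int) 1"
  have t: "monom (1::int) k = t ^ k" for k
    by (simp add: t_def monom_power)
  have "t \<noteq> 0" by (simp add: t_def)
  moreover have "t * (\<Sum>p\<in>perms_avoiding_123 n. t ^ des p) =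
      t * (\<Sum>e\<in>inv_seqs_avoiding_ge_any_ge n. t ^ dist_pos e)"
    using perms_gf[OF assms, of t] inv_seqs_gf[OF assms, of t] by (simp add: sum_distrib_left)
  ultimately show ?thesis by (simp add: t)
qed

end
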